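(* The group $E_{6(-26),\mathbb R}=\{\alpha\in \mathrm{Iso}_{\mathbb R}(\mathfrak J(3,\mathbb R)) \mid \det(\alpha X)=\det X \text{ for all } X\in\mathfrak J(3,\mathbb R)\}$ is isomorphic to the group $SL(3,\mathbb R)$.
   Context: $\mathfrak J(3,\mathbb R)$ is the real vector space of symmetric real $3\times3$ matrices, $\det$ is the usual determinant, and $\mathrm{Iso}_{\mathbb R}(V)$ is the group of $\mathbb R$-linear automorphisms of $V$. *)

theory Defs
  imports "HOL-Analysis.Analysis" "HOL-Algebra.Bij"
begin

definition J3 :: "(real^3^3) set" where
  "J3 = {X. transpose X = X}"

lemma subspace_J3: "subspace J3"
  by (auto simp: subspace_def J3_def transpose_def vec_eq_iff)

(* The automorphisms of a subspace V are represented as in HOL-Algebra.Bij: bijections of V that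
   are extensional (undefined outside V), so that equality in the group is equality on V. *)
definition linear_Iso :: "'a::real_vector set \<Rightarrow> ('a \<Rightarrow> 'a) monoid" where
  "linear_Iso V = (BijGroup V)\<lparr>carrier :=
     {f \<in> Bij V. (\<forall>x\<in>V. \<forall>y\<in>V. f (x + y) = f x + f y) \<and> (\<forall>c. \<forall>x\<in>V. f (c *\<^sub>R x) = c *\<^sub>R f x)}\<rparr>"

definition E6_26 :: "(real^3^3 \<Rightarrow> real^3^3) monoid" where
  "E6_26 = (linear_Iso J3)\<lparr>carrier :=
     {\<alpha> \<in> carrier (linear_Iso J3). \<forall>X\<in>J3. det (\<alpha> X) = det X}\<rparr>"

definition SL3 :: "(real^3^3) monoid" where
  "SL3 = \<lparr>carrier = {A. det A = 1}, mult = (**), one = mat 1\<rparr>"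

lemma group_linear_Iso:
  assumes "subspace V"
  shows "group (linear_Iso V)"
proof -
  interpret B: group "BijGroup V" by (rule group_BijGroup)
  let ?H = "carrier (linear_Iso V)"
  have H: "?H = {f \<in> Bij V. (\<forall>x\<in>V. \<forall>y\<in>V. f (x + y) = f x + f y)
      \<and> (\<forall>c. \<forall>x\<in>V. f (c *\<^sub>R x) = c *\<^sub>R f x)}"
    by (simp add: linear_Iso_def)
  have cl: "x + y \<in> V" "c *\<^sub>R x \<in> V" if "x \<in> V" "y \<in> V" for x y c
    using assms that by (auto intro: subspace_add subspace_scale)
  have "subgroup ?H (BijGroup V)"
  proof (rule B.subgroupI)
    show "?H \<subseteq> carrier (BijGroup V)" by (auto simp: H BijGroup_def)
    have "(\<lambda>x\<in>V. x) \<in> ?H" by (auto simp: H id_Bij cl)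
    then show "?H \<noteq> {}" by blast
  next
    fix f assume f: "f \<in> ?H"
    then have fB: "f \<in> Bij V" by (simp add: H)
    have bij: "inj_on f V" "f ` V = V" using fB by (auto simp: Bij_def bij_betw_def)
    have mem: "inv_into V f x \<in> V" if "x \<in> V" for x using Bij_inv_into_mem[OF fB that] .
    have r: "f (inv_into V f x) = x" if "x \<in> V" for x using that bij by (simp add: f_inv_into_f)
    have add: "inv_into V f (x + y) = inv_into V f x + inv_into V f y" if "x \<in> V" "y \<in> V" for x y
    proof (rule inv_into_f_eq[OF bij(1)])
      show "inv_into V f x + inv_into V f y \<in> V" using mem that cl by blast
      show "f (inv_into V f x + inv_into V f y) = x + y" using f mem r that by (simp add: H)
    qed
    have sc: "inv_into V f (c *\<^sub>R x) = c *\<^sub>R inv_into V f x" if "x \<in> V" for x c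
    proof (rule inv_into_f_eq[OF bij(1)])
      show "c *\<^sub>R inv_into V f x \<in> V" using mem that cl by blast
      show "f (c *\<^sub>R inv_into V f x) = c *\<^sub>R x" using f mem r that by (simp add: H)
    qed
    show "inv\<^bsub>BijGroup V\<^esub> f \<in> ?H"
      using fB by (auto simp: inv_BijGroup H restrict_inv_into_Bij add sc cl)
  next
    fix f g assume "f \<in> ?H" "g \<in> ?H"
    then show "f \<otimes>\<^bsub>BijGroup V\<^esub> g \<in> ?H"
      using Bij_imp_funcset[of g V]
      by (auto simp: H BijGroup_def compose_Bij compose_eq cl Pi_iff)
  qed
  then have "group ((BijGroup V)\<lparr>carrier := ?H\<rparr>)"
    by (rule B.subgroup_imp_group)
  then show ?thesis by (simp add: linear_Iso_def)
qed

lemma group_E6_26: "group E6_26"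
proof -
  interpret L: group "linear_Iso J3" by (rule group_linear_Iso[OF subspace_J3])
  let ?G = "linear_Iso J3"
  let ?H = "{\<alpha> \<in> carrier ?G. \<forall>X\<in>J3. det (\<alpha> X) = det X}"
  have B: "f \<in> Bij J3" if "f \<in> carrier ?G" for f using that by (simp add: linear_Iso_def)
  have mlt: "(f \<otimes>\<^bsub>?G\<^esub> g) X = f (g X)"
    if "f \<in> carrier ?G" "g \<in> carrier ?G" "X \<in> J3" for f g X
    using B[OF that(1)] B[OF that(2)] that(3) by (simp add: linear_Iso_def BijGroup_def compose_eq)
  have one: "\<one>\<^bsub>?G\<^esub> X = X" if "X \<in> J3" for X
    using that by (simp add: linear_Iso_def BijGroup_def)
  have mem: "f X \<in> J3" if "f \<in> carrier ?G" "X \<in> J3" for f X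
    using Bij_imp_funcset[OF B[OF that(1)]] that(2) by auto
  have "subgroup ?H ?G"
  proof (rule L.subgroupI)
    have "\<one>\<^bsub>?G\<^esub> \<in> ?H" using one by simp
    then show "?H \<noteq> {}" by blast
  next
    fix f assume f: "f \<in> ?H"
    have "det ((inv\<^bsub>?G\<^esub> f) X) = det X" if X: "X \<in> J3" for X
    proof -
      have "det (f ((inv\<^bsub>?G\<^esub> f) X)) = det ((inv\<^bsub>?G\<^esub> f) X)" using f X mem by simp
      moreover have "f ((inv\<^bsub>?G\<^esub> f) X) = X" using f X mlt[of f "inv\<^bsub>?G\<^esub> f" X] one by simp
      ultimately show ?thesis by simp
    qed
    then show "inv\<^bsub>?G\<^esub> f \<in> ?H" using f by simp
  qed (auto simp: mlt mem)
  then show ?thesis unfolding E6_26_def by (rule L.subgroup_imp_group)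
qed

lemma group_SL3: "group SL3"
proof (rule groupI)
  fix A assume "A \<in> carrier SL3"
  then have d: "det A = 1" by (simp add: SL3_def)
  then obtain B where B: "B ** A = mat 1" by (metis invertible_det_nz invertible_def zero_neq_one)
  then have "det B = 1" using d by (metis det_I det_mul mult.right_neutral)
  with B show "\<exists>B\<in>carrier SL3. B \<otimes>\<^bsub>SL3\<^esub> A = \<one>\<^bsub>SL3\<^esub>" by (auto simp: SL3_def)
qed (auto simp: SL3_def det_mul matrix_mul_assoc)

end

(* SL(3) acts on symmetric matrices by X |-> A X A^T, preserving det. The action is faithful because
   -1 has determinant -1. Conversely, a det-preserving linear map f of J3 preserves the set of
   matrices of rank at most one, since these are characterised by det alone:
   det (Y + X) + det (Y - X) = 2 det Y for all Y. Hence f sends the diagonal idempotents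
   e_i e_i^T to +- v_i v_i^T; composing f with the congruence by the inverse of the matrix with
   columns v_i, we may assume that f maps e_i e_i^T to +- e_i e_i^T. The rank-one curves
   (e_i + t e_j)(e_i + t e_j)^T then force f to be a congruence by a diagonal sign matrix. So f is a
   congruence by a matrix of determinant +-1, and replacing A by -A makes it 1. *)
theory Submission
  imports Defs "HOL-Algebra.Coset"
begin

section \<open>Rank-one squares, a basis of \<open>J3\<close>, and the congruence action\<close>

definition outer :: "real^'n \<Rightarrow> real^'n^'n" where
  "outer v = (\<chi> p q. v$p * v$q)"

text \<open>Polarisation of the quadratic map \<open>outer\<close>: for distinct indices this is
  E_ij + E_ji, and for \<open>i = j\<close> it is 2 E_ii.\<close>

definition sym_unit :: "'n \<Rightarrow> 'n \<Rightarrow> real^'n^'n" where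
  "sym_unit i j = outer (axis i 1 + axis j 1) - outer (axis i 1) - outer (axis j 1)"

text \<open>Rank at most one as a system of quadratic equations; repeated row or column indices give
  only trivial equations.\<close>

definition minors_vanish :: "real^'n^'n \<Rightarrow> bool" where
  "minors_vanish X \<longleftrightarrow> (\<forall>i j k l. X$i$j * X$k$l = X$i$l * X$k$j)"

text \<open>Restricting to \<open>J3\<close> makes the map extensional, so that it can be an element
  of \<open>E6_26\<close> itself.\<close>

definition congruence :: "real^3^3 \<Rightarrow> real^3^3 \<Rightarrow> real^3^3" where
  "congruence A = (\<lambda>X\<in>J3. A ** X ** transpose A)"

lemma axis_one_nth: "axis i (1::real) $ p = (if p = i then 1 else 0)"
  by (simp add: axis_def)

lemma outer_nth: "outer v $ p $ q = v$p * v$q"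
  by (simp add: outer_def)

lemma sym_unit_nth:
  "sym_unit i j $ p $ q =
    (if p = i then 1 else 0) * (if q = j then 1 else 0) + (if p = j then 1 else 0) * (if q = i then 1 else 0)"
  by (auto simp: sym_unit_def outer_def axis_one_nth)

lemma J3_iff: "X \<in> J3 \<longleftrightarrow> (\<forall>p q. X$p$q = X$q$p)"
  by (auto simp: J3_def transpose_def vec_eq_iff)

lemma outer_in_J3 [simp]: "outer v \<in> J3"
  by (simp add: J3_iff outer_nth)

lemma sym_unit_in_J3 [simp]: "sym_unit i j \<in> J3"
  by (auto simp: J3_iff sym_unit_nth)

lemma J3_closed:
  assumes "X \<in> J3" "Y \<in> J3"
  shows "X + Y \<in> J3" "X - Y \<in> J3"
  using assms by (auto simp: J3_iff)

lemma J3_scaleR: "X \<in> J3 \<Longrightarrow> c *\<^sub>R X \<in> J3"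
  by (simp add: J3_iff)

lemma J3_entries:
  assumes "X \<in> J3"
  shows "X$2$1 = X$1$2" "X$3$1 = X$1$3" "X$3$2 = X$2$3"
  using assms unfolding J3_iff by blast+

lemma J3_decomposition:
  assumes "X \<in> J3"
  shows "X = X$1$1 *\<^sub>R outer (axis 1 1) + X$2$2 *\<^sub>R outer (axis 2 1) + X$3$3 *\<^sub>R outer (axis 3 1)
    + X$1$2 *\<^sub>R sym_unit 1 2 + X$1$3 *\<^sub>R sym_unit 1 3 + X$2$3 *\<^sub>R sym_unit 2 3"
  by (simp add: J3_entries[OF assms] vec_eq_iff forall_3 outer_nth sym_unit_nth axis_one_nth)

lemma congruence_outer: "congruence A (outer v) = outer (A *v v)"
  by (simp add: congruence_def vec_eq_iff forall_3 outer_nth matrix_matrix_mult_def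
      matrix_vector_mult_def transpose_def sum_3 algebra_simps)

section \<open>Rank at most one: description by the determinant and normal form\<close>

text \<open>The difference of the two sides is \<open>2 * trace (adj X ** Y)\<close>, so it vanishes for all
  \<open>Y\<close> iff the adjugate of \<open>X\<close> is zero.\<close>

lemma minors_vanish_iff_det:
  assumes "X \<in> J3"
  shows "minors_vanish X \<longleftrightarrow> (\<forall>Y\<in>J3. det (Y + X) + det (Y - X) = 2 * det Y)"
proof
  assume m: "minors_vanish X"
  show "\<forall>Y\<in>J3. det (Y + X) + det (Y - X) = 2 * det Y"
  proof
    fix Y :: "real^3^3" assume "Y \<in> J3"
    have m': "X$i$j * X$k$l - X$i$l * X$k$j = 0" for i j k l
      using m by (simp add: minors_vanish_def)
    have "det (Y + X) + det (Y - X) - 2 * det Y =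
        2 * (Y$1$1 * (X$2$2 * X$3$3 - X$2$3 * X$3$2) - Y$1$2 * (X$2$1 * X$3$3 - X$2$3 * X$3$1)
          + Y$1$3 * (X$2$1 * X$3$2 - X$2$2 * X$3$1) - Y$2$1 * (X$1$2 * X$3$3 - X$1$3 * X$3$2)
          + Y$2$2 * (X$1$1 * X$3$3 - X$1$3 * X$3$1) - Y$2$3 * (X$1$1 * X$3$2 - X$1$2 * X$3$1)
          + Y$3$1 * (X$1$2 * X$2$3 - X$1$3 * X$2$2) - Y$3$2 * (X$1$1 * X$2$3 - X$1$3 * X$2$1)
          + Y$3$3 * (X$1$1 * X$2$2 - X$1$2 * X$2$1))"
      by (simp add: det_3 algebra_simps)
    then show "det (Y + X) + det (Y - X) = 2 * det Y"
      by (simp add: m')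
  qed
next
  assume *: "\<forall>Y\<in>J3. det (Y + X) + det (Y - X) = 2 * det Y"
  note s = J3_entries[OF assms]
  \<comment> \<open>Testing at the basis of \<open>J3\<close> isolates the cofactors of
    \<open>X\<close>: a diagonal idempotent gives a principal minor, \<open>sym_unit i j\<close> an
    off-diagonal cofactor.\<close>
  note D = *[rule_format, OF outer_in_J3[of "axis _ 1"]] *[rule_format, OF sym_unit_in_J3]
  note defs = det_3 outer_nth sym_unit_nth axis_one_nth s algebra_simps
  have "X$1$1 * X$2$2 = X$1$2 * X$1$2" using D(1)[of 3] by (simp add: defs)
  moreover have "X$1$1 * X$3$3 = X$1$3 * X$1$3" using D(1)[of 2] by (simp add: defs)
  moreover have "X$2$2 * X$3$3 = X$2$3 * X$2$3" using D(1)[of 1] by (simp add: defs)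
  moreover have "X$1$1 * X$2$3 = X$1$2 * X$1$3" using D(2)[of 2 3] by (simp add: defs)
  moreover have "X$2$2 * X$1$3 = X$1$2 * X$2$3" using D(2)[of 1 3] by (simp add: defs)
  moreover have "X$3$3 * X$1$2 = X$1$3 * X$2$3" using D(2)[of 1 2] by (simp add: defs)
  ultimately show "minors_vanish X"
    by (simp add: minors_vanish_def forall_3 s mult.commute)
qed

lemma minors_vanish_outer: "minors_vanish (outer v)"
  by (simp add: minors_vanish_def outer_nth)

text \<open>With a pivot \<open>X$p$p\<close> different from 0, the minors give X_ij = X_pi X_pj /
  X_pp. Row \<open>p\<close> divided by the square root of |X_pp| serves as \<open>v\<close>, and
  the sign of the pivot as \<open>e\<close>.\<close>

lemma minors_vanish_imp_outer:
  assumes "minors_vanish X" "\<forall>p q. X$p$q = X$q$p"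
  obtains e v where "e * e = 1" "X = e *\<^sub>R outer v"
proof (cases "X = 0")
  case True
  then have "X = 1 *\<^sub>R outer 0" by (simp add: vec_eq_iff outer_nth)
  then show ?thesis using that[of 1 0] by simp
next
  case False
  have m: "X$i$j * X$k$l = X$i$l * X$k$j" for i j k l
    using assms(1) by (simp add: minors_vanish_def)
  obtain p q where "X$p$q \<noteq> 0" using False by (auto simp: vec_eq_iff)
  \<comment> \<open>By symmetry this product is the square of \<open>X$p$q\<close>, so a nonzero
    entry forces a nonzero diagonal entry.\<close>
  then have "X$p$p * X$q$q \<noteq> 0" using m[of p p q q] assms(2) by simp
  then have nz: "X$p$p \<noteq> 0" by simp
  define v where "v = (\<chi> i. X$p$i / sqrt \<bar>X$p$p\<bar>)"
  define e where "e = sgn (X$p$p)"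
  have "X $ i $ j = e * (v$i * v$j)" for i j
  proof -
    have "e * (v$i * v$j) = sgn (X$p$p) / \<bar>X$p$p\<bar> * (X$p$i * X$p$j)"
      by (simp add: v_def e_def)
    also have "\<dots> = X$p$i * X$p$j / X$p$p" by (simp add: sgn_if)
    also have "\<dots> = X$i$j" using m[of p p i j] assms(2) nz by (simp add: field_simps)
    finally show ?thesis by simp
  qed
  then have "X = e *\<^sub>R outer v" by (simp add: vec_eq_iff outer_nth)
  moreover have "e * e = 1" using nz by (simp add: e_def sgn_if)
  ultimately show ?thesis using that by blast
qed

section \<open>Elements of \<open>E6_26\<close> and their effect on rank-one matrices\<close>

lemma E6_26_carrierD:
  assumes "f \<in> carrier E6_26"
  shows "X \<in> J3 \<Longrightarrow> f X \<in> J3"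
    and "X \<in> J3 \<Longrightarrow> Y \<in> J3 \<Longrightarrow> f (X + Y) = f X + f Y"
    and "X \<in> J3 \<Longrightarrow> f (c *\<^sub>R X) = c *\<^sub>R f X"
    and "X \<in> J3 \<Longrightarrow> det (f X) = det X"
    and "f ` J3 = J3" and "f \<in> extensional J3"
  using assms by (auto simp: E6_26_def linear_Iso_def Bij_def bij_betw_def)

lemma E6_26_mult:
  assumes "f \<in> carrier E6_26" "g \<in> carrier E6_26"
  shows "f \<otimes>\<^bsub>E6_26\<^esub> g = compose J3 f g"
  using assms by (simp add: E6_26_def linear_Iso_def BijGroup_def)

text \<open>The criterion \<open>minors_vanish_iff_det\<close> involves only \<open>det\<close> and
  the linear structure. It transfers along \<open>f\<close> because every test matrix
  \<open>Z\<close> is some \<open>f Y\<close>.\<close>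

lemma E6_26_minors_vanish:
  assumes f: "f \<in> carrier E6_26" and X: "X \<in> J3" "minors_vanish X"
  shows "minors_vanish (f X)"
proof -
  have "det (Z + f X) + det (Z - f X) = 2 * det Z" if "Z \<in> J3" for Z
  proof -
    have "Z \<in> f ` J3" using that by (simp only: E6_26_carrierD(5)[OF f])
    then obtain Y where Y: "Y \<in> J3" "Z = f Y" by blast
    have "f (Y + (-1) *\<^sub>R X) = f Y + (-1) *\<^sub>R f X"
      using X Y by (simp only: E6_26_carrierD(2,3)[OF f] J3_scaleR)
    then have "f (Y - X) = f Y - f X" by simp
    moreover have "f (Y + X) = f Y + f X" using X Y by (simp add: E6_26_carrierD[OF f])
    ultimately show ?thesis
      using X Y minors_vanish_iff_det[of X] E6_26_carrierD(4)[OF f] J3_closed J3_scaleR by metis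
  qed
  then show ?thesis using minors_vanish_iff_det E6_26_carrierD(1)[OF f] X by blast
qed

section \<open>Congruences as group elements, and the kernel of the action\<close>

lemma congruence_in_J3: "X \<in> J3 \<Longrightarrow> congruence A X \<in> J3"
  by (simp add: congruence_def J3_def matrix_transpose_mul matrix_mul_assoc)

lemma congruence_mult: "compose J3 (congruence A) (congruence B) = congruence (A ** B)"
proof
  fix X show "compose J3 (congruence A) (congruence B) X = congruence (A ** B) X"
    using congruence_in_J3[of X B]
    by (auto simp: congruence_def compose_def matrix_transpose_mul matrix_mul_assoc)
qed

lemma congruence_one: "congruence (mat 1) = (\<lambda>X\<in>J3. X)"
  by (simp add: congruence_def transpose_mat)

lemma congruence_in_E6_26:
  assumes "det A * det A = 1"
  shows "congruence A \<in> carrier E6_26"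
proof -
  have "det A \<noteq> 0" using assms by auto
  then obtain B where B: "A ** B = mat 1" "B ** A = mat 1"
    by (metis invertible_det_nz invertible_def)
  have c: "congruence C (congruence D X) = X" if "C ** D = mat 1" "X \<in> J3" for C D X
    using that congruence_mult[of C D] congruence_one by (metis compose_eq restrict_apply')
  have "bij_betw (congruence A) J3 J3"
    by (rule bij_betw_byWitness[where f' = "congruence B"]) (auto simp: c B congruence_in_J3)
  moreover have "A ** (X + Y) ** transpose A = A ** X ** transpose A + A ** Y ** transpose A" for X Y
    by (simp add: vec_eq_iff matrix_matrix_mult_def sum.distrib algebra_simps)
  moreover have "A ** (c *\<^sub>R X) ** transpose A = c *\<^sub>R (A ** X ** transpose A)" for c X
    by (simp add: vec_eq_iff matrix_matrix_mult_def sum_distrib_left algebra_simps)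
  ultimately show ?thesis
    using assms
    by (simp add: E6_26_def linear_Iso_def Bij_def congruence_def J3_closed J3_scaleR det_mul)
qed

text \<open>Evaluating on the squares of the e_i makes \<open>C\<close> diagonal with entries of
  square 1, and the squares of e_i + e_j make these entries equal. A scalar c with c^2 = 1 and c^3 =
  1 is 1.\<close>

lemma congruence_eq_one:
  assumes "congruence C = (\<lambda>X\<in>J3. X)" "det C = 1"
  shows "C = mat 1"
proof -
  have "outer (C *v v) = outer v" for v
    using congruence_outer[of C v] assms(1) by simp
  then have q: "(C *v v)$p * (C *v v)$q = v$p * v$q" for v p q
    by (metis outer_nth)
  have col: "(C *v axis i 1)$p = C$p$i" for p i
    by (simp add: matrix_vector_mult_basis column_def)
  have off: "C$p$i = 0" if "p \<noteq> i" for p i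
    using q[of "axis i 1" p p] that by (simp add: col axis_one_nth)
  have sq: "C$i$i * C$i$i = 1" for i
    using q[of "axis i 1" i i] by (simp add: col)
  have "C$i$i * C$j$j = 1" for i j
  proof (cases "i = j")
    case False
    then show ?thesis
      using q[of "axis i 1 + axis j 1" i j] by (simp add: matrix_vector_right_distrib col off axis_one_nth)
  qed (simp add: sq)
  then have eq: "C$i$i = C$j$j" for i j
    by (metis mult.assoc mult.right_neutral mult.left_neutral)
  have "C$1$1 * C$2$2 * C$3$3 = 1"
    using assms(2) by (simp add: det_3 off)
  then have "C$1$1 = 1" by (metis eq sq mult.left_neutral)
  then have "C$i$i = 1" for i using eq by metis
  then show ?thesis by (simp add: vec_eq_iff mat_def off)
qed

section \<open>Maps that preserve the diagonal idempotents up to sign\<close>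

lemma outer_axis_line:
  "outer (axis i 1 + t *\<^sub>R axis j 1) = outer (axis i 1) + t *\<^sub>R sym_unit i j + (t * t) *\<^sub>R outer (axis j 1)"
  by (simp add: vec_eq_iff outer_nth sym_unit_def algebra_simps)

text \<open>The image under \<open>f\<close> of the curve \<open>outer_axis_line\<close> has rank at
  most one for every \<open>t\<close>. Comparing coefficients in \<open>t\<close> of its principal
  2x2 minors determines \<open>f (sym_unit i j)\<close> up to a sign.\<close>

lemma diagonal_sym_unit:
  fixes i j :: 3
  assumes f: "f \<in> carrier E6_26" and ij: "i \<noteq> j"
    and diag: "\<And>i. f (outer (axis i 1)) = e i *\<^sub>R outer (axis i 1)"
    and e: "\<And>i. e i * e i = 1"
  obtains s where "s * s = 1" "e i = e j" "f (sym_unit i j) = s *\<^sub>R sym_unit i j"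
proof -
  define M where "M = f (sym_unit i j)"
  have sym: "M$p$q = M$q$p" for p q
    using E6_26_carrierD(1)[OF f sym_unit_in_J3[of i j]] by (simp add: M_def J3_iff)
  have nz: "e i \<noteq> 0" for i using e[of i] by auto
  define N where "N t = e i *\<^sub>R outer (axis i 1) + t *\<^sub>R M + (t * t * e j) *\<^sub>R outer (axis j 1)" for t
  have "N t = f (outer (axis i 1 + t *\<^sub>R axis j 1))" for t
    by (simp add: outer_axis_line N_def M_def diag J3_closed J3_scaleR E6_26_carrierD(2,3)[OF f])
  then have "minors_vanish (N t)" for t
    by (metis E6_26_minors_vanish f minors_vanish_outer outer_in_J3)
  moreover have "N t$q$p = N t$p$q" for t p q
    by (simp add: N_def outer_nth sym[of q p])
  ultimately have m: "N t$p$p * N t$q$q = N t$p$q * N t$p$q" for t p q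
    by (metis minors_vanish_def)
  have N: "N t$i$i = e i + t * M$i$i" "N t$j$j = t * M$j$j + t * t * e j" "N t$i$j = t * M$i$j" for t
    using ij by (simp_all add: N_def outer_nth axis_one_nth)
  have Nk: "N t$k$k = t * M$k$k" "N t$i$k = t * M$i$k" "N t$j$k = t * M$j$k" if "k \<noteq> i" "k \<noteq> j" for t k
    using that by (simp_all add: N_def outer_nth axis_one_nth)
  have "M$i$i = 0 \<and> M$j$j = 0 \<and> M$i$j * M$i$j = e i * e j"
  proof -
    \<comment> \<open>A polynomial identity with terms in t, t^2 and t^3; the values 1, -1 and 2 of
      \<open>t\<close> suffice to separate the three coefficients.\<close>
    have 1: "(e i + t * M$i$i) * (t * M$j$j + t * t * e j) = t * M$i$j * (t * M$i$j)" for t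
      using m[of t i j] by (simp add: N)
    have a: "e i * M$j$j + M$i$i * e j = 0"
      using 1[of 1] 1[of "-1"] by (simp add: algebra_simps)
    have b: "e i * e j + M$i$i * M$j$j = M$i$j * M$i$j"
      using 1[of 1] 1[of "-1"] by (simp add: algebra_simps)
    have "2 * (e i * M$j$j) + 8 * (M$i$i * e j) + 4 * (e i * e j + M$i$i * M$j$j) = 4 * (M$i$j * M$i$j)"
      using 1[of 2] by (simp add: algebra_simps)
    then have "M$i$i * e j = 0" using a b by algebra
    then show ?thesis using a b nz by simp
  qed
  moreover have k: "M$k$k = 0 \<and> M$i$k = 0 \<and> M$j$k = 0" if "k \<noteq> i" "k \<noteq> j" for k
  proof -
    have 1: "(e i + t * M$i$i) * (t * M$k$k) = t * M$i$k * (t * M$i$k)" for t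
      using m[of t i k] by (simp add: N Nk that)
    have "e i * M$k$k = 0" using 1[of 1] 1[of "-1"] by (simp add: algebra_simps)
    then have z: "M$k$k = 0" using nz by simp
    then show ?thesis using 1[of 1] m[of 1 j k] by (simp add: Nk that)
  qed
  ultimately have z: "M$i$i = 0" "M$j$j = 0" and s: "M$i$j * M$i$j = e i * e j" by auto
  \<comment> \<open>The product is a square, hence nonnegative, and its own square is 1.\<close>
  have ee: "e i * e j = 1"
  proof -
    have "(e i * e j) * (e i * e j) = 1" using e by (simp add: algebra_simps flip: mult.assoc)
    moreover have "e i * e j \<ge> 0" using s by (metis zero_le_square)
    ultimately show ?thesis by (smt (verit) mult_cancel_right1 square_eq_1_iff)
  qed
  from ee have eq: "e i = e j" using e[of j] nz[of j] by (metis mult_right_cancel)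
  have M: "M = M$i$j *\<^sub>R sym_unit i j"
  proof (intro vec_eq_iff[THEN iffD2] allI)
    fix p q
    \<comment> \<open>Only one index differs from both \<open>i\<close> and \<open>j\<close>, so an
      entry outside their rows and columns is diagonal.\<close>
    have third: "p = i \<or> p = j \<or> q = i \<or> q = j \<or> p = q"
      using ij by (metis (full_types) exhaust_3)
    show "M$p$q = (M$i$j *\<^sub>R sym_unit i j)$p$q"
      using third ij z k[of p] k[of q] sym[of p q] sym[of j i] by (auto simp: sym_unit_nth)
  qed
  show ?thesis using that[OF trans[OF s ee] eq] M unfolding M_def by blast
qed

text \<open>On the standard basis \<open>f\<close> acts by one common sign \<open>e 1\<close> and by
  signs \<open>a\<close>, \<open>b\<close>, \<open>c\<close>. The determinants of two test matrices
  give \<open>e 1 = 1\<close> and \<open>a * b * c = 1\<close>, which is exactly what a diagonal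
  congruence requires.\<close>

lemma diagonal_is_congruence:
  assumes f: "f \<in> carrier E6_26"
    and diag: "\<And>i. f (outer (axis i 1)) = e i *\<^sub>R outer (axis i 1)"
    and e: "\<And>i. e i * e i = 1"
  obtains D where "det D * det D = 1" "f = congruence D"
proof -
  obtain a where a: "a * a = 1" "e 1 = e 2" "f (sym_unit 1 2) = a *\<^sub>R sym_unit 1 2"
    by (rule diagonal_sym_unit[OF f _ diag e, of 1 2]) (simp, blast)
  obtain b where b: "b * b = 1" "e 1 = e 3" "f (sym_unit 1 3) = b *\<^sub>R sym_unit 1 3"
    by (rule diagonal_sym_unit[OF f _ diag e, of 1 3]) (simp, blast)
  obtain c where c: "c * c = 1" "f (sym_unit 2 3) = c *\<^sub>R sym_unit 2 3"
    by (rule diagonal_sym_unit[OF f _ diag e, of 2 3]) (simp, blast)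
  have fX: "f X = X$1$1 *\<^sub>R e 1 *\<^sub>R outer (axis 1 1) + X$2$2 *\<^sub>R e 1 *\<^sub>R outer (axis 2 1)
    + X$3$3 *\<^sub>R e 1 *\<^sub>R outer (axis 3 1) + X$1$2 *\<^sub>R a *\<^sub>R sym_unit 1 2
    + X$1$3 *\<^sub>R b *\<^sub>R sym_unit 1 3 + X$2$3 *\<^sub>R c *\<^sub>R sym_unit 2 3" if "X \<in> J3" for X
    by (subst J3_decomposition[OF that])
      (simp add: E6_26_carrierD(2,3)[OF f] J3_closed J3_scaleR diag a b c flip: a(2) b(2))
  note entries = outer_nth sym_unit_nth axis_one_nth
  have "mat 1 \<in> J3" by (simp add: J3_def transpose_mat)
  then have "det (f (mat 1)) = 1" using E6_26_carrierD(4)[OF f] by simp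
  then have "e 1 * e 1 * e 1 = 1"
    using fX[OF \<open>mat 1 \<in> J3\<close>] by (simp add: det_3 mat_def entries)
  then have e1: "e 1 = 1" by (simp add: e)
  \<comment> \<open>Zero diagonal and ones elsewhere: \<open>det Z\<close> is 2, while
    \<open>det (f Z)\<close> is 2abc.\<close>
  define Z :: "real^3^3" where "Z = sym_unit 1 2 + sym_unit 1 3 + sym_unit 2 3"
  have Z: "Z \<in> J3" by (simp add: Z_def J3_closed J3_scaleR)
  have "det (f Z) = det Z" using E6_26_carrierD(4)[OF f Z] .
  then have abc: "a * b * c = 1"
    using fX[OF Z] by (simp add: Z_def det_3 entries)
  \<comment> \<open>Congruence by diag(1, a, b) multiplies the entries 12, 13, 23 by a, b, ab, and
    ab = c.\<close>
  define D :: "real^3^3" where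
    "D = (\<chi> p q. if p = q then (if p = 1 then 1 else if p = 2 then a else b) else 0)"
  have "c = a * b" using abc c(1) by (metis mult.assoc mult.right_neutral mult.left_neutral)
  moreover have "a * (a * x) = x" "b * (b * x) = x" for x
    using a(1) b(1) by (simp_all flip: mult.assoc)
  ultimately have "f X = D ** X ** transpose D" if "X \<in> J3" for X
    unfolding fX[OF that] using a(1) b(1)
    by (simp add: J3_entries[OF that] vec_eq_iff forall_3 entries D_def e1
        matrix_matrix_mult_def transpose_def sum_3 mult_ac)
  then have "f = congruence D"
    using E6_26_carrierD(6)[OF f] by (auto simp: congruence_def extensional_def)
  moreover have "det D * det D = (a * a) * (b * b)"
    by (simp add: det_3 D_def)
  ultimately show ?thesis using that a b by simp
qed

section \<open>Reduction of an arbitrary element to the diagonal case\<close>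

lemma E6_26_is_congruence:
  assumes f: "f \<in> carrier E6_26"
  obtains A where "det A * det A = 1" "f = congruence A"
proof -
  interpret E: group E6_26 by (rule group_E6_26)
  have "\<exists>e v. e * e = 1 \<and> f (outer (axis i 1)) = e *\<^sub>R outer v" for i
    using minors_vanish_imp_outer[of "f (outer (axis i 1))"]
      E6_26_minors_vanish[OF f outer_in_J3 minors_vanish_outer] E6_26_carrierD(1)[OF f outer_in_J3]
    unfolding J3_iff by metis
  then obtain e v where e: "\<And>i. e i * e i = (1::real)"
    and v: "\<And>i. f (outer (axis i 1)) = e i *\<^sub>R outer (v i)" by metis
  define V :: "real^3^3" where "V = (\<chi> p q. v q $ p)"
  have Vv: "V *v axis i 1 = v i" for i
    by (simp add: matrix_vector_mult_basis column_def V_def vec_eq_iff)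
  define E :: "real^3^3" where "E = (\<chi> p q. if p = q then e p else 0)"
  \<comment> \<open>The image of the identity is V E V^T and has determinant 1; this shows that
    \<open>V\<close> is invertible, i.e. that the vectors \<open>v i\<close> are
    independent.\<close>
  have "(mat 1 :: real^3^3) = outer (axis 1 1) + outer (axis 2 1) + outer (axis 3 1)"
    by (simp add: vec_eq_iff forall_3 mat_def outer_nth axis_one_nth)
  then have "f (mat 1) = e 1 *\<^sub>R outer (v 1) + e 2 *\<^sub>R outer (v 2) + e 3 *\<^sub>R outer (v 3)"
    by (simp add: E6_26_carrierD(2)[OF f] J3_closed J3_scaleR v)
  moreover have "det (f (mat 1)) = 1"
    using E6_26_carrierD(4)[OF f, of "mat 1"] by (simp add: J3_def transpose_mat)
  moreover have "e 1 *\<^sub>R outer (v 1) + e 2 *\<^sub>R outer (v 2) + e 3 *\<^sub>R outer (v 3) = V ** E ** transpose V"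
    by (simp add: vec_eq_iff outer_nth V_def E_def matrix_matrix_mult_def transpose_def sum_3 mult_ac)
  moreover have "det E = e 1 * e 2 * e 3"
    by (simp add: det_3 E_def)
  ultimately have 1: "e 1 * e 2 * e 3 * (det V * det V) = 1"
    by (simp add: det_mul mult_ac)
  have "(e 1 * e 2 * e 3) * (e 1 * e 2 * e 3) = (e 1 * e 1) * (e 2 * e 2) * (e 3 * e 3)"
    by (simp only: mult_ac)
  then have "(e 1 * e 2 * e 3) * (e 1 * e 2 * e 3) = 1" by (simp add: e)
  then have "e 1 * e 2 * e 3 = 1 \<or> e 1 * e 2 * e 3 = -1" by (simp add: square_eq_1_iff)
  \<comment> \<open>The sign product cannot be -1, because \<open>det V * det V\<close> is
    nonnegative.\<close>
  then have V1: "det V * det V = 1"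
    using 1 by (metis mult_minus1 mult_1 minus_equation_iff not_one_le_zero neg_0_le_iff_le zero_le_square)
  then have "det V \<noteq> 0" by auto
  then obtain W where W: "V ** W = mat 1" "W ** V = mat 1"
    by (metis invertible_det_nz invertible_def)
  have "det V * det W = 1" using W(1) by (metis det_I det_mul)
  then have W1: "det W * det W = 1" using V1
    by (metis mult.assoc mult.left_commute mult.right_neutral)
  \<comment> \<open>\<open>W\<close> inverts \<open>V\<close> and sends each \<open>v i\<close> back
    to the axis vector, so \<open>g\<close> satisfies the hypotheses of
    \<open>diagonal_is_congruence\<close>.\<close>
  define g where "g = congruence W \<otimes>\<^bsub>E6_26\<^esub> f"
  have g: "g \<in> carrier E6_26" unfolding g_def by (intro E.m_closed congruence_in_E6_26 W1 f)
  have "g (outer (axis i 1)) = e i *\<^sub>R outer (axis i 1)" for i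
  proof -
    have "W *v v i = axis i 1"
      by (metis Vv W(2) matrix_vector_mul_assoc matrix_vector_mul_lid)
    then have "congruence W (e i *\<^sub>R outer (v i)) = e i *\<^sub>R outer (axis i 1)"
      by (simp add: E6_26_carrierD(3)[OF congruence_in_E6_26[OF W1]] congruence_outer)
    then show ?thesis
      by (simp add: g_def E6_26_mult[OF congruence_in_E6_26[OF W1] f] compose_eq v)
  qed
  then obtain D where D: "det D * det D = 1" "g = congruence D"
    using diagonal_is_congruence[OF g] e by metis
  note VE = congruence_in_E6_26[OF V1] and WE = congruence_in_E6_26[OF W1]
  have "congruence V \<otimes>\<^bsub>E6_26\<^esub> congruence W = \<one>\<^bsub>E6_26\<^esub>"
    by (simp add: E6_26_mult VE WE congruence_mult W congruence_one)
      (simp add: E6_26_def linear_Iso_def BijGroup_def)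
  then have "f = congruence V \<otimes>\<^bsub>E6_26\<^esub> g"
    using VE WE f by (simp add: g_def flip: E.m_assoc)
  then have "f = congruence (V ** D)"
    using E6_26_mult[OF VE g] by (simp add: D(2) congruence_mult)
  moreover have "det (V ** D) * det (V ** D) = (det V * det V) * (det D * det D)"
    by (simp add: det_mul)
  ultimately show ?thesis using that V1 D(1) by simp
qed

section \<open>The congruence action as an isomorphism from \<open>SL3\<close> onto
  \<open>E6_26\<close>\<close>

theorem theorem3p0p7:
  shows "E6_26 \<cong> SL3"
proof -
  interpret E: group E6_26 by (rule group_E6_26)
  interpret S: group SL3 by (rule group_SL3)
  have mem: "congruence A \<in> carrier E6_26" if "A \<in> carrier SL3" for A
    using that by (simp add: SL3_def congruence_in_E6_26)
  have "congruence \<in> hom SL3 E6_26"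
  proof (rule homI)
    fix A B assume "A \<in> carrier SL3" "B \<in> carrier SL3"
    then show "congruence (A \<otimes>\<^bsub>SL3\<^esub> B) = congruence A \<otimes>\<^bsub>E6_26\<^esub> congruence B"
      by (simp add: E6_26_mult mem congruence_mult) (simp add: SL3_def)
  qed (rule mem)
  then interpret h: group_hom SL3 E6_26 congruence
    by (simp add: group_hom_def group_hom_axioms_def E.is_group S.is_group)
  have "inj_on congruence (carrier SL3)"
    unfolding h.inj_on_one_iff
  proof (intro allI impI)
    fix A assume "A \<in> carrier SL3" "congruence A = \<one>\<^bsub>E6_26\<^esub>"
    then show "A = \<one>\<^bsub>SL3\<^esub>"
      using congruence_eq_one[of A] by (simp add: SL3_def E6_26_def linear_Iso_def BijGroup_def)
  qed
  moreover have "f \<in> congruence ` carrier SL3" if "f \<in> carrier E6_26" for f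
  proof -
    obtain A where A: "det A * det A = 1" "f = congruence A"
      using E6_26_is_congruence \<open>f \<in> carrier E6_26\<close> by blast
    show ?thesis
    proof (cases "det A = 1")
      case True
      with A show ?thesis by (auto simp: SL3_def)
    next
      case False
      with A have "det A = -1" by (simp add: square_eq_1_iff)
      \<comment> \<open>Negation flips the determinant because the dimension is odd, while the two
        signs cancel in the congruence.\<close>
      then have "det (- A) = 1" by (simp add: det_3)
      moreover have "congruence (- A) = congruence A"
        by (simp add: congruence_def fun_eq_iff vec_eq_iff matrix_matrix_mult_def transpose_def
            sum_negf restrict_def)
      ultimately show ?thesis using A by (auto simp: SL3_def image_iff intro!: bexI[of _ "- A"])
    qed
  qed
  ultimately have "congruence \<in> iso SL3 E6_26"
    using h.homh mem by (auto simp: iso_def bij_betw_def)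
  then show ?thesis using S.iso_sym is_isoI by blast
qed

end
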